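(* Let $B_{11}$ be the graph obtained from the complete graph on vertices $z_1,\dots,z_5,z_1',\dots,z_5'$ by deleting the five edges $z_iz_i'$ ($i=1,\dots,5$) and then adding a new vertex $v$ adjacent exactly to $z_1,\dots,z_5$. Then $B_{11}$ has an inside-obstacle representation (in fact with a triangular obstacle) but has no outside-obstacle representation.
   Context: An obstacle is a topologically open, non-self-intersecting polygonal region in the plane (possibly unbounded). Given an obstacle $C$ and a finite set $P$ of points in general position in the complement of $C$, the visibility graph $G_C(P)$ has vertex set $P$ and an edge $pq$ exactly when $\overline{pq}\cap C=\emptyset$; its straight-line drawing is the visibility drawing. A single-obstacle representation of $G$ is a pair $(P,C)$ with $G\cong G_C(P)$; it is an outside-obstacle representation if $C$ lies in the unbounded component of the complement of the visibility drawing, and an inside-obstacle representation if $C$ lies in the complement of that unbounded component. *)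

theory Defs
  imports "HOL-Analysis.Analysis"
begin

type_synonym point = "real^2"

definition polygonal_set :: "point set \<Rightarrow> bool" where
  "polygonal_set S \<longleftrightarrow> (\<exists>F. finite F \<and> S = \<Union>F \<and>
     (\<forall>X\<in>F. (\<exists>a b. X = closed_segment a b) \<or>
              (\<exists>a d. d \<noteq> 0 \<and> X = {a + t *\<^sub>R d | t. t \<ge> 0})))"

definition obstacle :: "point set \<Rightarrow> bool" where
  "obstacle C \<longleftrightarrow> open C \<and> connected C \<and> C \<noteq> {} \<and> polygonal_set (frontier C) \<and>
     (frontier C homeomorphic sphere (0::point) 1 \<or> frontier C homeomorphic (UNIV::real set))"

definition general_position :: "point set \<Rightarrow> bool" where
  "general_position P \<longleftrightarrow> (\<forall>S\<subseteq>P. card S = 3 \<longrightarrow> \<not> collinear S)"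

definition single_obstacle_rep ::
  "'v set \<Rightarrow> ('v \<Rightarrow> 'v \<Rightarrow> bool) \<Rightarrow> ('v \<Rightarrow> point) \<Rightarrow> point set \<Rightarrow> bool" where
  "single_obstacle_rep V adj f C \<longleftrightarrow> obstacle C \<and> finite V \<and> inj_on f V \<and>
     general_position (f ` V) \<and> f ` V \<inter> C = {} \<and>
     (\<forall>u\<in>V. \<forall>w\<in>V. adj u w \<longleftrightarrow> u \<noteq> w \<and> closed_segment (f u) (f w) \<inter> C = {})"

definition drawing :: "'v set \<Rightarrow> ('v \<Rightarrow> 'v \<Rightarrow> bool) \<Rightarrow> ('v \<Rightarrow> point) \<Rightarrow> point set" where
  "drawing V adj f = f ` V \<union>
     \<Union>{closed_segment (f u) (f w) | u w. u \<in> V \<and> w \<in> V \<and> adj u w}"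

definition outside_obstacle_rep ::
  "'v set \<Rightarrow> ('v \<Rightarrow> 'v \<Rightarrow> bool) \<Rightarrow> ('v \<Rightarrow> point) \<Rightarrow> point set \<Rightarrow> bool" where
  "outside_obstacle_rep V adj f C \<longleftrightarrow> single_obstacle_rep V adj f C \<and>
     (\<exists>K\<in>components (- drawing V adj f). \<not> bounded K \<and> C \<subseteq> K)"

definition inside_obstacle_rep ::
  "'v set \<Rightarrow> ('v \<Rightarrow> 'v \<Rightarrow> bool) \<Rightarrow> ('v \<Rightarrow> point) \<Rightarrow> point set \<Rightarrow> bool" where
  "inside_obstacle_rep V adj f C \<longleftrightarrow> single_obstacle_rep V adj f C \<and>
     (\<forall>K\<in>components (- drawing V adj f). \<not> bounded K \<longrightarrow> C \<inter> K = {})"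

text \<open>B11: vertex 0 = v, vertices 1..5 = z_1..z_5, vertices 6..10 = z_1'..z_5'.\<close>
definition B11_V :: "nat set" where
  "B11_V = {0..10}"

definition B11_adj :: "nat \<Rightarrow> nat \<Rightarrow> bool" where
  "B11_adj u w \<longleftrightarrow> u \<in> B11_V \<and> w \<in> B11_V \<and> u \<noteq> w \<and>
     (if u = 0 then w \<in> {1..5}
      else if w = 0 then u \<in> {1..5}
      else \<not> (u = w + 5 \<or> w = u + 5))"

end

theory Submission
  imports Defs
begin

text \<open>
  Let the obstacle lie in the unbounded face \<open>K\<close> of the drawing. If \<open>x\<close> and \<open>y\<close> are not adjacent, all
  common neighbours of \<open>x\<close> and \<open>y\<close> lie on one side of the line \<open>x y\<close>: otherwise two of them span with
  \<open>x\<close> and \<open>y\<close> a 4-cycle of edges with \<open>x y\<close> in its interior, so that \<open>K\<close> does not reach \<open>x y\<close>.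
  Therefore each \<open>z\<^sub>i z\<^sub>i'\<close> is a side of the convex hull of the \<open>z\<^sub>j\<close> and \<open>z\<^sub>j'\<close>, and no line \<open>v z\<^sub>i'\<close>
  separates the \<open>z\<^sub>j\<close> with \<open>j \<noteq> i\<close>. The latter implies that \<open>v\<close> lies in no triangle of the \<open>z\<^sub>j\<close>, so these
  are linearly ordered by angle around \<open>v\<close>, say with first \<open>z\<^sub>s\<close> and last \<open>z\<^sub>t\<close>. For each of the three
  other indices \<open>i\<close>, one of the lines \<open>v z\<^sub>s\<close>, \<open>v z\<^sub>t\<close> separates \<open>z\<^sub>i\<close> from \<open>z\<^sub>i'\<close>, so one of these lines
  crosses two of the hull sides \<open>z\<^sub>i z\<^sub>i'\<close> and passes through a further hull vertex, which is impossible.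
\<close>


section \<open>Orientation determinants of point triples\<close>

definition orient :: "point \<Rightarrow> point \<Rightarrow> point \<Rightarrow> real" where
  "orient p q r = (q$1 - p$1) * (r$2 - p$2) - (q$2 - p$2) * (r$1 - p$1)"

lemma orient_swap: "orient p r q = - orient p q r"
  by (simp add: orient_def algebra_simps)

lemma orient_refl [simp]: "orient p p q = 0" "orient p q q = 0" "orient p q p = 0"
  by (simp_all add: orient_def)

lemma orient_comb:
  assumes "u + w = 1"
  shows "orient p q (u *\<^sub>R a + w *\<^sub>R b) = u * orient p q a + w * orient p q b"
proof -
  have u: "u = 1 - w" using assms by simp
  show ?thesis by (simp add: u orient_def algebra_simps)
qed

lemma orient_collinear:
  assumes "p \<noteq> q" "orient p q r = 0"
  shows "\<exists>t. r = p + t *\<^sub>R (q - p)"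
proof (cases "q$1 = p$1")
  case True
  then have "q$2 \<noteq> p$2" using assms(1) by (auto simp: vec_eq_iff forall_2)
  then show ?thesis using assms(2) True
    by (intro exI[of _ "(r$2 - p$2) / (q$2 - p$2)"]) (auto simp: vec_eq_iff forall_2 orient_def)
next
  case False
  define t where "t = (r$1 - p$1) / (q$1 - p$1)"
  have t1: "r$1 - p$1 = t * (q$1 - p$1)" using False by (simp add: t_def)
  have "(q$1 - p$1) * (r$2 - p$2) = (q$1 - p$1) * (t * (q$2 - p$2))"
    using assms(2) unfolding orient_def t1 by (simp add: algebra_simps)
  then have "r$2 - p$2 = t * (q$2 - p$2)" using False by simp
  with t1 have "r = p + t *\<^sub>R (q - p)" by (simp add: vec_eq_iff forall_2)
  then show ?thesis ..
qed

lemma collinear_3_iff_orient: "collinear {p, q, r} \<longleftrightarrow> orient p q r = 0"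
proof
  assume "collinear {p, q, r}"
  then obtain u where u: "\<forall>x\<in>{p,q,r}. \<forall>y\<in>{p,q,r}. \<exists>c. x - y = c *\<^sub>R u"
    unfolding collinear_def by blast
  then obtain c d where c: "q - p = c *\<^sub>R u" and d: "r - p = d *\<^sub>R u" by blast
  have "q$1 - p$1 = c * u$1" "q$2 - p$2 = c * u$2" "r$1 - p$1 = d * u$1" "r$2 - p$2 = d * u$2"
    using c d by (metis vector_minus_component vector_scaleR_component real_scaleR_def)+
  then show "orient p q r = 0" by (simp add: orient_def)
next
  assume o: "orient p q r = 0"
  show "collinear {p, q, r}"
  proof (cases "p = q")
    case False
    then obtain t where "r = p + t *\<^sub>R (q - p)" using orient_collinear o by blast
    then show ?thesis unfolding collinear_alt
      by (intro exI[of _ p] exI[of _ "q - p"]) (auto intro: exI[of _ 0] exI[of _ 1])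
  qed simp
qed

text \<open>The factor \<open>c\<close> carries a sign, so one statement covers both open half
  planes of a line; convexity comes from \<open>orient p q\<close> being affine.\<close>

lemma convex_orient_pos: "convex {x. 0 < c * orient p q x}"
proof (rule convexI)
  fix x y :: point and u w :: real
  assume xy: "x \<in> {x. 0 < c * orient p q x}" "y \<in> {x. 0 < c * orient p q x}"
    and uw: "0 \<le> u" "0 \<le> w" "u + w = 1"
  have "0 < u * (c * orient p q x) + w * (c * orient p q y)"
  proof (cases "u = 0")
    case False
    then show ?thesis using xy uw by (intro add_pos_nonneg) auto
  qed (use xy uw in auto)
  then show "u *\<^sub>R x + w *\<^sub>R y \<in> {x. 0 < c * orient p q x}"
    using uw by (simp add: orient_comb algebra_simps)
qed

lemma convex_orient_zero: "convex {x. orient p q x = 0}"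
  by (rule convexI) (auto simp: orient_comb)

section \<open>Hull sides and the angular order\<close>

text \<open>A convex curve is met by a line through one of its points in at most one further point.\<close>
lemma two_sides_separated:
  assumes "p \<noteq> v"
    and p: "0 < a * orient p p' q" "0 < a * orient p p' q'"
      "0 < a * orient p p' r" "0 < a * orient p p' r'"
    and q: "0 < b * orient q q' p" "0 < b * orient q q' r" "0 < b * orient q q' r'"
    and r: "0 < c * orient r r' p" "0 < c * orient r r' q" "0 < c * orient r r' q'"
    and sep: "orient v p q * orient v p q' < 0" "orient v p r * orient v p r' < 0"
  shows False
proof -
  have cross: "\<exists>x\<in>closed_segment q q'. orient v p x = 0"
    if "orient v p q * orient v p q' < 0" for q q'
  proof -
    \<comment> \<open>An affine function with values \<open>?s\<close> and \<open>?s'\<close> of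
      opposite sign at the end points vanishes at the parameter
      \<open>?s / (?s - ?s')\<close>.\<close>
    let ?s = "orient v p q" and ?s' = "orient v p q'"
    have ne: "?s - ?s' \<noteq> 0" using that by auto
    have "(0 < ?s \<and> ?s' < 0) \<or> (?s < 0 \<and> 0 < ?s')" using that by (auto simp: mult_less_0_iff)
    then have "0 \<le> ?s / (?s - ?s')" "?s / (?s - ?s') \<le> 1" by (auto simp: divide_simps)
    moreover have "orient v p ((1 - ?s / (?s - ?s')) *\<^sub>R q + (?s / (?s - ?s')) *\<^sub>R q') = 0"
      using ne by (subst orient_comb) (auto simp: left_diff_distrib diff_divide_distrib [symmetric] field_simps)
    ultimately show ?thesis
      by (intro bexI[of _ "(1 - ?s / (?s - ?s')) *\<^sub>R q + (?s / (?s - ?s')) *\<^sub>R q'"])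
        (auto simp only: in_segment mem_Collect_eq)
  qed
  have pos: "0 < d * orient s t x"
    if "x \<in> closed_segment y z" "0 < d * orient s t y" "0 < d * orient s t z" for d s t x y z
    using closed_segment_subset[OF _ _ convex_orient_pos[of d s t]] that by blast
  have zero: "orient s t x = 0" if "x \<in> closed_segment s t" for s t x
  proof -
    have "closed_segment s t \<subseteq> {x. orient s t x = 0}"
      by (intro closed_segment_subset convex_orient_zero) auto
    then show ?thesis using that by blast
  qed
  obtain x where x: "x \<in> closed_segment q q'" "orient v p x = 0" using cross sep(1) by blast
  obtain y where y: "y \<in> closed_segment r r'" "orient v p y = 0" using cross sep(2) by blast
  have xs: "0 < a * orient p p' x" "orient q q' x = 0" "0 < c * orient r r' x"
    using pos zero x p r by blast+
  have ys: "0 < a * orient p p' y" "orient r r' y = 0" "0 < b * orient q q' y"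
    using pos zero y p q by blast+
  obtain s t where s: "x = v + s *\<^sub>R (p - v)" and t: "y = v + t *\<^sub>R (p - v)"
    using orient_collinear x y \<open>p \<noteq> v\<close> by metis
  have "collinear {x, y, p}"
    unfolding collinear_alt s t
    by (intro exI[of _ v] exI[of _ "p - v"]) (auto intro: exI[of _ 1])
  \<comment> \<open>The side through the middle one of the three points has the other two strictly
    on one side, so the middle point would lie strictly off a line that contains it.\<close>
  then consider "x \<in> closed_segment y p" | "y \<in> closed_segment p x" | "p \<in> closed_segment x y"
    by (auto simp: collinear_between_cases between_mem_segment)
  then show False
  proof cases
    case 1 then show False using pos[OF 1 ys(3) q(1)] xs by simp
  next
    case 2 then show False using pos[OF 2 r(1) xs(3)] ys by simp
  next
    case 3 then show False using pos[OF 3 xs(1) ys(1)] by simp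
  qed
qed


text \<open>The existential multiplier \<open>a\<close> expresses an unknown common sign. Five pairs
  suffice for the count: three indices remain besides the extreme ones, and each of two lines
  accounts for at most one of them.\<close>

lemma matching_visibility_contradiction:
  fixes Z Z' :: "nat \<Rightarrow> point"
  assumes I: "finite I" "card I = 5"
    and gen: "\<And>i j. i \<in> I \<Longrightarrow> j \<in> I \<Longrightarrow> i \<noteq> j \<Longrightarrow> orient v (Z i) (Z j) \<noteq> 0"
      "\<And>i j. i \<in> I \<Longrightarrow> j \<in> I \<Longrightarrow> i \<noteq> j \<Longrightarrow> orient v (Z' i) (Z j) \<noteq> 0"
    and side: "\<And>i. i \<in> I \<Longrightarrow> \<exists>a. \<forall>j\<in>I - {i}. 0 < a * orient (Z i) (Z' i) (Z j) \<and> 0 < a * orient (Z i) (Z' i) (Z' j)"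
    and vis: "\<And>i. i \<in> I \<Longrightarrow> \<exists>a. \<forall>j\<in>I - {i}. 0 < a * orient v (Z' i) (Z j)"
  shows False
proof -
  \<comment> \<open>Angular order around \<open>v\<close>: \<open>Z j\<close> lies counterclockwise
    of \<open>Z i\<close> by less than half a turn.\<close>
  define R where "R i j \<longleftrightarrow> 0 < orient v (Z i) (Z j)" for i j
  have total: "R i j \<or> R j i" if "i \<in> I" "j \<in> I" "i \<noteq> j" for i j
    using gen(1)[OF that] orient_swap[of v "Z i" "Z j"] by (auto simp: R_def)
  have asym: "\<not> R j i" if "R i j" for i j
    using that orient_swap[of v "Z i" "Z j"] by (auto simp: R_def)
  \<comment> \<open>A 3-cycle would put \<open>v\<close> inside the triangle of the three points. As
    \<open>I\<close> has five elements there is a further index \<open>m\<close>, and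
    \<open>vis\<close> for \<open>m\<close> puts the whole triangle on one side of a line through
    \<open>v\<close>.\<close>
  have no_cycle: "\<not> R k i" if ijk: "i \<in> I" "j \<in> I" "k \<in> I" and "R i j" "R j k" for i j k
  proof
    assume "R k i"
    have "card {i, j, k} \<le> 3" by (simp add: card_insert_if)
    then have "\<not> I \<subseteq> {i, j, k}" using I card_mono[of "{i,j,k}" I] by auto
    then obtain m where m: "m \<in> I" "m \<noteq> i" "m \<noteq> j" "m \<noteq> k" by auto
    obtain a where a: "\<forall>j\<in>I - {m}. 0 < a * orient v (Z' m) (Z j)" using vis m by blast
    \<comment> \<open>Grassmann-Pluecker relation for the four vectors from \<open>v\<close>.
      Multiplied by \<open>a\<close>, its terms are all positive.\<close>
    have "orient v (Z j) (Z k) * orient v (Z' m) (Z i) + orient v (Z k) (Z i) * orient v (Z' m) (Z j)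
        + orient v (Z i) (Z j) * orient v (Z' m) (Z k) = 0"
      by (simp add: orient_def algebra_simps)
    then have "orient v (Z j) (Z k) * (a * orient v (Z' m) (Z i)) + orient v (Z k) (Z i) * (a * orient v (Z' m) (Z j))
        + orient v (Z i) (Z j) * (a * orient v (Z' m) (Z k)) = 0"
      by (metis (no_types, lifting) distrib_left mult.left_commute mult_zero_right)
    moreover have "0 < orient v (Z j) (Z k) * (a * orient v (Z' m) (Z i)) + orient v (Z k) (Z i) * (a * orient v (Z' m) (Z j))
        + orient v (Z i) (Z j) * (a * orient v (Z' m) (Z k))"
      using a ijk m \<open>R i j\<close> \<open>R j k\<close> \<open>R k i\<close>
      by (intro add_pos_pos mult_pos_pos[of "orient v _ _" "a * _"]) (auto simp: R_def)
    ultimately show False by simp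
  qed
  have R: "totalp_on I R" using total by (auto simp: totalp_on_def)
  \<comment> \<open>A tournament without 3-cycles is transitive, hence a linear order with a first
    and a last element.\<close>
  have "transp_on I R"
  proof (rule transp_onI)
    fix i j k assume ijk: "i \<in> I" "j \<in> I" "k \<in> I" "R i j" "R j k"
    then have "i \<noteq> k" using asym by blast
    then show "R i k" using total[of i k] no_cycle[of i j k] ijk by blast
  qed
  note R = this R
  have "I \<noteq> {}" using I by auto
  obtain s where s: "s \<in> I" "\<And>i. i \<in> I \<Longrightarrow> i \<noteq> s \<Longrightarrow> R s i"
    using Finite_Set.bex_least_element[OF I(1) \<open>I \<noteq> {}\<close> R] by blast
  obtain t where t: "t \<in> I" "\<And>i. i \<in> I \<Longrightarrow> i \<noteq> t \<Longrightarrow> R i t"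
    using Finite_Set.bex_greatest_element[OF I(1) \<open>I \<noteq> {}\<close> R] by blast
  define S where "S p = {i \<in> I - {s, t}. orient v (Z p) (Z i) * orient v (Z p) (Z' i) < 0}" for p
  \<comment> \<open>\<open>Z i\<close> is to the left of the ray from \<open>v\<close> to
    \<open>Z s\<close> and to the right of the one to \<open>Z t\<close>. By \<open>vis\<close>,
    \<open>Z s\<close> and \<open>Z t\<close> are on the same side of the line through
    \<open>v\<close> and \<open>Z' i\<close>; the sign of \<open>a\<close> decides which of the two
    rays has \<open>Z' i\<close> on its other side.\<close>
  have cover: "I - {s, t} \<subseteq> S s \<union> S t"
  proof
    fix i assume i: "i \<in> I - {s, t}"
    have pos: "0 < orient v (Z s) (Z i)" and neg: "orient v (Z t) (Z i) < 0"
      using s(2)[of i] t(2)[of i] i orient_swap[of v "Z i" "Z t"] by (auto simp: R_def)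
    obtain a where "0 < a * orient v (Z' i) (Z s)" "0 < a * orient v (Z' i) (Z t)"
      using vis[of i] i s(1) t(1) by blast
    then have "orient v (Z s) (Z' i) < 0 \<or> 0 < orient v (Z t) (Z' i)"
      unfolding orient_swap[of v "Z s"] orient_swap[of v "Z t"] by (auto simp: zero_less_mult_iff)
    then show "i \<in> S s \<union> S t" using pos neg i by (auto simp: S_def mult_less_0_iff)
  qed
  have small: "card (S p) \<le> 1" if p: "p \<in> {s, t}" for p
  proof (rule ccontr)
    assume "\<not> card (S p) \<le> 1"
    then obtain q r where qr: "q \<in> S p" "r \<in> S p" "q \<noteq> r"
      by (metis One_nat_def card_le_Suc0_iff_eq card.infinite zero_le)
    have pI: "p \<in> I" and qrI: "q \<in> I" "r \<in> I" "q \<noteq> p" "r \<noteq> p" using s t p qr by (auto simp: S_def)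
    have "Z p \<noteq> v" using gen(1)[OF pI qrI(1)] qrI by auto
    moreover obtain a where "\<forall>j\<in>I - {p}. 0 < a * orient (Z p) (Z' p) (Z j) \<and> 0 < a * orient (Z p) (Z' p) (Z' j)"
      using side pI by blast
    moreover obtain b where "\<forall>j\<in>I - {q}. 0 < b * orient (Z q) (Z' q) (Z j) \<and> 0 < b * orient (Z q) (Z' q) (Z' j)"
      using side qrI by blast
    moreover obtain c where "\<forall>j\<in>I - {r}. 0 < c * orient (Z r) (Z' r) (Z j) \<and> 0 < c * orient (Z r) (Z' r) (Z' j)"
      using side qrI by blast
    ultimately show False
      using qr pI qrI
      by (intro two_sides_separated[of "Z p" v a "Z' p" "Z q" "Z' q" "Z r" "Z' r" b c]) (auto simp: S_def)
  qed
  \<comment> \<open>The case \<open>s = t\<close> need not be ruled out: it only leaves more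
    indices.\<close>
  have "card (I - {s, t}) \<ge> 3"
    using I s t card_Diff_subset[of "{s,t}" I] by (cases "s = t") auto
  moreover have "card (I - {s, t}) \<le> card (S s) + card (S t)"
    using I cover by (intro order_trans[OF card_mono card_Un_le]) (auto simp: S_def)
  ultimately show False using small[of s] small[of t] by simp
qed

section \<open>Triangles that shut out an unbounded component\<close>

text \<open>Barycentric coordinates are quotients of signed areas (Cramer's rule); dividing makes
  the condition independent of the orientation of the triangle.\<close>

lemma mem_triangle_orient:
  assumes "orient x y z \<noteq> 0" "0 \<le> orient p y z / orient x y z" "0 \<le> orient x p z / orient x y z"
    "0 \<le> orient x y p / orient x y z"
  shows "p \<in> convex hull {x, y, z}"
proof -
  let ?d = "orient x y z"
  let ?u = "orient p y z / ?d" and ?v = "orient x p z / ?d" and ?w = "orient x y p / ?d"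
  have "?u *\<^sub>R x + ?v *\<^sub>R y + ?w *\<^sub>R z
      = (1 / ?d) *\<^sub>R (orient p y z *\<^sub>R x + orient x p z *\<^sub>R y + orient x y p *\<^sub>R z)"
    by (simp add: scaleR_add_right)
  also have "orient p y z *\<^sub>R x + orient x p z *\<^sub>R y + orient x y p *\<^sub>R z = ?d *\<^sub>R p"
    by (simp add: vec_eq_iff forall_2 orient_def algebra_simps)
  finally have "p = ?u *\<^sub>R x + ?v *\<^sub>R y + ?w *\<^sub>R z"
    using assms(1) by simp
  moreover have "?u + ?v + ?w = (orient p y z + orient x p z + orient x y p) / ?d"
    by (simp add: add_divide_distrib)
  moreover have "orient p y z + orient x p z + orient x y p = ?d"
    by (simp add: orient_def algebra_simps)
  ultimately show ?thesis unfolding convex_hull_3 using assms by force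
qed

text \<open>A connected set that meets \<open>T\<close> but avoids its frontier cannot leave
  \<open>T\<close>.\<close>

lemma bounded_component_enclosed:
  fixes T :: "'a::real_normed_vector set"
  assumes "connected K" "K \<inter> frontier T = {}" "K \<inter> T \<noteq> {}" "bounded T"
  shows "bounded K"
  using connected_Int_frontier[of K T] assms by (metis Diff_eq_empty_iff bounded_subset)

text \<open>The two triangles on the common side \<open>x y\<close> form a bounded region. Their
  other sides lie in \<open>D\<close>, so \<open>K\<close> could touch its frontier only on
  \<open>x y\<close>, and there the points of \<open>K\<close> turn out to be interior.\<close>

lemma unbounded_component_blocked:
  fixes D :: "point set"
  assumes K: "K \<in> components (- D)" "\<not> bounded K"
    and D: "closed_segment x a \<subseteq> D" "closed_segment x b \<subseteq> D"
      "closed_segment y a \<subseteq> D" "closed_segment y b \<subseteq> D"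
    and opp: "orient x y a * orient x y b < 0"
  shows "closed_segment x y \<inter> K = {}"
proof (rule ccontr)
  assume "closed_segment x y \<inter> K \<noteq> {}"
  then obtain q where q: "q \<in> closed_segment x y" "q \<in> K" by blast
  have KD: "K \<inter> D = {}" using K(1) in_components_subset by blast
  define A where "A c = convex hull {x, y, c}" for c
  \<comment> \<open>The coordinates at \<open>x\<close> and \<open>y\<close> are positive with
    respect to both triangles. The third coordinate is nonnegative for one of them, as
    \<open>a\<close> and \<open>b\<close> are on opposite sides.\<close>
  define U where "U = (\<Inter>c\<in>{a,b}. {r. 0 < orient x r c / orient x y c} \<inter> {r. 0 < orient r y c / orient x y c})"
  have nz: "orient x y a \<noteq> 0" "orient x y b \<noteq> 0" using opp by auto
  have "open U" unfolding U_def orient_def divide_inverse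
    by (intro open_INT ballI open_Int open_Collect_less continuous_intros) auto
  moreover have "U \<subseteq> A a \<union> A b"
  proof
    fix r assume "r \<in> U"
    moreover have "0 \<le> orient x y r / orient x y a \<or> 0 \<le> orient x y r / orient x y b"
      using opp by (auto simp: zero_le_divide_iff mult_less_0_iff)
    ultimately show "r \<in> A a \<union> A b"
      using mem_triangle_orient[of x y a r] mem_triangle_orient[of x y b r] nz
      by (auto simp: U_def A_def less_imp_le)
  qed
  ultimately have int: "U \<subseteq> interior (A a \<union> A b)" by (simp add: interior_maximal)
  have U: "p \<in> U" if p: "p \<in> closed_segment x y" "p \<in> K" for p
  proof -
    obtain t where t: "0 \<le> t" "t \<le> 1" "p = (1 - t) *\<^sub>R x + t *\<^sub>R y" using p(1) by (auto simp: in_segment)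
    have "p \<noteq> x" "p \<noteq> y" using p(2) KD D by auto
    then have t': "0 < t" "t < 1" using t by (auto simp: less_le)
    have "orient x p c = t * orient x y c" "orient p y c = (1 - t) * orient x y c" for c
      unfolding t(3) by (simp_all add: orient_def algebra_simps)
    then show "p \<in> U" using t' nz by (auto simp: U_def)
  qed
  have "frontier (A a \<union> A b) \<subseteq> D \<union> closed_segment x y"
    using frontier_Un_subset[of "A a" "A b"] D
    by (auto simp: A_def frontier_of_triangle closed_segment_commute)
  then have "K \<inter> frontier (A a \<union> A b) = {}"
    using KD U int by (auto simp: frontier_def)
  moreover have "K \<inter> (A a \<union> A b) \<noteq> {}" using q U int interior_subset by blast
  moreover have "bounded (A a \<union> A b)" by (simp add: A_def finite_imp_bounded_convex_hull)
  moreover have "connected K" using K(1) in_components_connected by blast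
  ultimately show False using K(2) bounded_component_enclosed by blast
qed

section \<open>Outside representations\<close>

lemma drawing_edge:
  "u \<in> V \<Longrightarrow> w \<in> V \<Longrightarrow> adj u w \<Longrightarrow> closed_segment (f u) (f w) \<subseteq> drawing V adj f"
  unfolding drawing_def by blast

lemma outside_rep_same_side:
  assumes rep: "outside_obstacle_rep V adj f C"
    and V: "x \<in> V" "y \<in> V" "a \<in> V" "b \<in> V"
    and adj: "x \<noteq> y" "\<not> adj x y" "adj x a" "adj x b" "adj y a" "adj y b"
  shows "0 \<le> orient (f x) (f y) (f a) * orient (f x) (f y) (f b)"
proof (rule ccontr)
  assume opp: "\<not> ?thesis"
  obtain K where K: "K \<in> components (- drawing V adj f)" "\<not> bounded K" "C \<subseteq> K"
    using rep by (auto simp: outside_obstacle_rep_def)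
  have "closed_segment (f x) (f y) \<inter> K = {}"
    using opp by (intro unbounded_component_blocked[OF K(1,2), of _ "f a" "f b"] drawing_edge V adj) auto
  moreover have "closed_segment (f x) (f y) \<inter> C \<noteq> {}"
    using rep V adj by (auto simp: outside_obstacle_rep_def single_obstacle_rep_def)
  ultimately show False using K(3) by blast
qed

lemma general_position_orient:
  assumes "general_position (f ` V)" "inj_on f V" "x \<in> V" "y \<in> V" "z \<in> V" "x \<noteq> y" "x \<noteq> z" "y \<noteq> z"
  shows "orient (f x) (f y) (f z) \<noteq> 0"
proof -
  have "card {f x, f y, f z} = 3" using assms by (auto simp: inj_on_eq_iff)
  moreover have "{f x, f y, f z} \<subseteq> f ` V" using assms by auto
  ultimately have "\<not> collinear {f x, f y, f z}" using assms(1) unfolding general_position_def by metis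
  then show ?thesis by (simp add: collinear_3_iff_orient)
qed

lemma B11_no_outside_rep: "\<not> outside_obstacle_rep B11_V B11_adj f C"
proof
  assume rep: "outside_obstacle_rep B11_V B11_adj f C"
  then have gp: "general_position (f ` B11_V)" "inj_on f B11_V"
    by (auto simp: outside_obstacle_rep_def single_obstacle_rep_def)
  have nz: "orient (f x) (f y) (f z) \<noteq> 0"
    if "x \<le> 10" "y \<le> 10" "z \<le> 10" "x \<noteq> y" "x \<noteq> z" "y \<noteq> z" for x y z
    using general_position_orient[OF gp] that by (auto simp: B11_V_def)
  have same: "\<exists>a. \<forall>w\<in>W. 0 < a * orient (f x) (f y) (f w)"
    if W: "\<forall>w\<in>W. w \<le> 10 \<and> w \<noteq> x \<and> w \<noteq> y \<and> B11_adj x w \<and> B11_adj y w"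
      and "x \<le> 10" "y \<le> 10" "x \<noteq> y" "\<not> B11_adj x y" for x y W
  proof (cases "W = {}")
    case False
    then obtain u where u: "u \<in> W" by blast
    \<comment> \<open>The orientation of one fixed \<open>u\<close> serves as the multiplier;
      general position makes the inequality strict.\<close>
    have "0 < orient (f x) (f y) (f u) * orient (f x) (f y) (f w)" if w: "w \<in> W" for w
    proof -
      have "0 \<le> orient (f x) (f y) (f u) * orient (f x) (f y) (f w)"
        using W u w that \<open>x \<le> 10\<close> \<open>y \<le> 10\<close> \<open>x \<noteq> y\<close> \<open>\<not> B11_adj x y\<close>
        by (intro outside_rep_same_side[OF rep]) (auto simp: B11_V_def)
      moreover have "orient (f x) (f y) (f u) \<noteq> 0" "orient (f x) (f y) (f w) \<noteq> 0"
        using W u w \<open>x \<le> 10\<close> \<open>y \<le> 10\<close> \<open>x \<noteq> y\<close> by (intro nz; auto)+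
      ultimately show ?thesis by (simp add: less_le)
    qed
    then show ?thesis by blast
  qed auto
  show False
  proof (rule matching_visibility_contradiction[of "{1..5}" "f 0" f "\<lambda>i. f (i + 5)"])
    fix i :: nat assume i: "i \<in> {1..5}"
    obtain a where "\<forall>w\<in>{1..10} - {i, i + 5}. 0 < a * orient (f i) (f (i + 5)) (f w)"
      using same[of "{1..10} - {i, i + 5}" i "i + 5"] i by (force simp: B11_adj_def B11_V_def)
    then show "\<exists>a. \<forall>j\<in>{1..5} - {i}. 0 < a * orient (f i) (f (i + 5)) (f j) \<and>
        0 < a * orient (f i) (f (i + 5)) (f (j + 5))"
      using i by (intro exI[of _ a]) auto
    \<comment> \<open>The common neighbours of \<open>v\<close> and its non-neighbour
      \<open>i + 5\<close> are the four \<open>j\<close> other than \<open>i\<close>.\<close>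
    show "\<exists>a. \<forall>j\<in>{1..5} - {i}. 0 < a * orient (f 0) (f (i + 5)) (f j)"
      using i by (intro same) (auto simp: B11_adj_def B11_V_def)
  next
    fix i j :: nat assume ij: "i \<in> {1..5}" "j \<in> {1..5}" "i \<noteq> j"
    show "orient (f 0) (f i) (f j) \<noteq> 0" "orient (f 0) (f (i + 5)) (f j) \<noteq> 0"
      using ij nz[of 0 i j] nz[of 0 "i + 5" j] by auto
  qed auto
qed


section \<open>An inside representation with a triangular obstacle\<close>

text \<open>
  The vertices \<open>z\<^sub>1, \<dots>, z\<^sub>5\<close> lie far above the obstacle, \<open>z\<^sub>i' = - z\<^sub>i\<close>, and \<open>v\<close> lies just above the
  horizontal side of the obstacle. Hence the diameters \<open>z\<^sub>i z\<^sub>i'\<close> and all segments \<open>v z\<^sub>i'\<close> cross the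
  line \<open>y = - 1\<close> inside the obstacle, while the other chords pass far from the origin.
\<close>

definition B11_x :: "nat \<Rightarrow> int" where
  "B11_x n = [1, 100, 60, 0, - 60, - 100, - 100, - 60, 0, 60, 100] ! n"

definition B11_y :: "nat \<Rightarrow> int" where
  "B11_y n = [1, 30, 80, 100, 80, 30, - 30, - 80, - 100, - 80, - 30] ! n"

lemma B11_x_simps [simp]:
  "B11_x 0 = 1" "B11_x 1 = 100" "B11_x (Suc 0) = 100" "B11_x 2 = 60" "B11_x 3 = 0" "B11_x 4 = - 60" "B11_x 5 = - 100"
  "B11_x 6 = - 100" "B11_x 7 = - 60" "B11_x 8 = 0" "B11_x 9 = 60" "B11_x 10 = 100"
  by (simp_all add: B11_x_def)

lemma B11_y_simps [simp]:
  "B11_y 0 = 1" "B11_y 1 = 30" "B11_y (Suc 0) = 30" "B11_y 2 = 80" "B11_y 3 = 100" "B11_y 4 = 80" "B11_y 5 = 30"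
  "B11_y 6 = - 30" "B11_y 7 = - 80" "B11_y 8 = - 100" "B11_y 9 = - 80" "B11_y 10 = - 30"
  by (simp_all add: B11_y_def)

definition B11_pos :: "nat \<Rightarrow> point" where
  "B11_pos n = vector [of_int (B11_x n), of_int (B11_y n)]"

lemma B11_pos_nth [simp]: "B11_pos n $ 1 = of_int (B11_x n)" "B11_pos n $ 2 = of_int (B11_y n)"
  by (simp_all add: B11_pos_def)

text \<open>Integer version of \<open>orient\<close>, so that the sign checks over all vertices
  become integer arithmetic.\<close>

definition int_orient :: "nat \<Rightarrow> nat \<Rightarrow> int \<Rightarrow> int \<Rightarrow> int" where
  "int_orient i j x y = (B11_x j - B11_x i) * (y - B11_y i) - (B11_y j - B11_y i) * (x - B11_x i)"

lemma orient_B11_pos: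
  "p $ 1 = of_int x \<Longrightarrow> p $ 2 = of_int y \<Longrightarrow> orient (B11_pos i) (B11_pos j) p = of_int (int_orient i j x y)"
  by (simp add: orient_def int_orient_def)

lemma B11_V_eq: "B11_V = {0, 1, 2, 3, 4, 5, 6, 7, 8, 9, 10}"
  unfolding B11_V_def by (auto; presburger)

lemma int_orient_B11_nonzero:
  "\<forall>k\<in>B11_V. \<forall>j\<in>B11_V. \<forall>i\<in>B11_V. i < j \<longrightarrow> j < k \<longrightarrow> int_orient i j (B11_x k) (B11_y k) \<noteq> 0"
  unfolding B11_V_eq int_orient_def by simp

text \<open>The points (-10, 0), (10, 0), (0, -10) are the corners of the obstacle: an edge stays in
  the closed upper half plane, or its line has the whole triangle strictly on one side.\<close>

lemma B11_adj_pos: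
  assumes "u \<in> B11_V" "w \<in> B11_V" "B11_adj u w"
  shows "(0 \<le> B11_y u \<and> 0 \<le> B11_y w) \<or>
    (0 < int_orient u w (- 10) 0 \<and> 0 < int_orient u w 10 0 \<and> 0 < int_orient u w 0 (- 10)) \<or>
    (int_orient u w (- 10) 0 < 0 \<and> int_orient u w 10 0 < 0 \<and> int_orient u w 0 (- 10) < 0)"
proof -
  have "\<forall>u\<in>B11_V. \<forall>w\<in>B11_V. u \<noteq> w \<longrightarrow> u \<noteq> w + 5 \<longrightarrow> w \<noteq> u + 5 \<longrightarrow> (u = 0 \<longrightarrow> w < 6) \<longrightarrow> (w = 0 \<longrightarrow> u < 6) \<longrightarrow>
    (0 \<le> B11_y u \<and> 0 \<le> B11_y w) \<or>
    (0 < int_orient u w (- 10) 0 \<and> 0 < int_orient u w 10 0 \<and> 0 < int_orient u w 0 (- 10)) \<or>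
    (int_orient u w (- 10) 0 < 0 \<and> int_orient u w 10 0 < 0 \<and> int_orient u w 0 (- 10) < 0)"
    unfolding B11_V_eq int_orient_def by simp
  moreover have "u \<noteq> w \<and> (u = 0 \<longrightarrow> w < 6) \<and> (w = 0 \<longrightarrow> u < 6) \<and> (u = w + 5 \<longrightarrow> w = 0) \<and> (w = u + 5 \<longrightarrow> u = 0)"
    using assms(3) by (auto simp: B11_adj_def split: if_splits)
  \<comment> \<open>The index test for matched pairs also discards the edge between 0 and 5; that
    edge lies in the upper half plane.\<close>
  ultimately show ?thesis using assms
    by (cases "u = w + 5 \<or> w = u + 5") auto
qed

text \<open>Multiplied by the height difference, the last inequality says that the segment crosses
  the line y = -1 at an abscissa below 9 in absolute value. At that height the obstacle has
  half-width 9.\<close>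

lemma not_B11_adj_pos:
  assumes "u \<in> B11_V" "w \<in> B11_V" "u < w" "\<not> B11_adj u w"
  shows "0 < B11_y u" "B11_y w < - 1"
    "\<bar>B11_x u * (B11_y u - B11_y w) + (B11_y u + 1) * (B11_x w - B11_x u)\<bar> < 9 * (B11_y u - B11_y w)"
proof -
  have "\<forall>u\<in>B11_V. \<forall>w\<in>B11_V. (u = 0 \<and> 5 < w) \<or> (0 < u \<and> w = u + 5) \<longrightarrow> 0 < B11_y u \<and> B11_y w < - 1 \<and>
    \<bar>B11_x u * (B11_y u - B11_y w) + (B11_y u + 1) * (B11_x w - B11_x u)\<bar> < 9 * (B11_y u - B11_y w)"
    unfolding B11_V_eq by simp
  moreover have "(u = 0 \<and> 5 < w) \<or> (0 < u \<and> w = u + 5)"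
    using assms by (auto simp: B11_adj_def split: if_splits)
  ultimately show "0 < B11_y u" "B11_y w < - 1"
    "\<bar>B11_x u * (B11_y u - B11_y w) + (B11_y u + 1) * (B11_x w - B11_x u)\<bar> < 9 * (B11_y u - B11_y w)"
    using assms by blast+
qed

definition obst_a :: point where "obst_a = vector [- 10, 0]"
definition obst_b :: point where "obst_b = vector [10, 0]"
definition obst_c :: point where "obst_c = vector [0, - 10]"
definition obst :: "point set" where "obst = interior (convex hull {obst_a, obst_b, obst_c})"

lemma obst_nth [simp]:
  "obst_a $ 1 = - 10" "obst_a $ 2 = 0" "obst_b $ 1 = 10" "obst_b $ 2 = 0"
  "obst_c $ 1 = 0" "obst_c $ 2 = - 10"
  by (simp_all add: obst_a_def obst_b_def obst_c_def)

lemma obst_not_collinear: "\<not> collinear {obst_a, obst_b, obst_c}"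
  by (simp add: collinear_3_iff_orient orient_def)

lemma mem_obst_iff: "p \<in> obst \<longleftrightarrow> p $ 2 < 0 \<and> \<bar>p $ 1\<bar> < 10 + p $ 2"
proof -
  have "DIM(point) = 2" by simp
  then have "p \<in> obst \<longleftrightarrow> (\<exists>x y z. 0 < x \<and> 0 < y \<and> 0 < z \<and> x + y + z = 1 \<and>
      x *\<^sub>R obst_a + y *\<^sub>R obst_b + z *\<^sub>R obst_c = p)"
    by (simp add: obst_def interior_convex_hull_3_minimal[OF obst_not_collinear])
  also have "\<dots> \<longleftrightarrow> (\<exists>x y z. 0 < x \<and> 0 < y \<and> 0 < z \<and> x + y + z = 1 \<and>
      10 * y - 10 * x = p $ 1 \<and> - (10 * z) = p $ 2)"
    by (simp add: vec_eq_iff forall_2 mult.commute)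
  also have "\<dots> \<longleftrightarrow> p $ 2 < 0 \<and> \<bar>p $ 1\<bar> < 10 + p $ 2"
  proof
    assume "p $ 2 < 0 \<and> \<bar>p $ 1\<bar> < 10 + p $ 2"
    then show "\<exists>x y z. 0 < x \<and> 0 < y \<and> 0 < z \<and> x + y + z = 1 \<and> 10 * y - 10 * x = p $ 1 \<and> - (10 * z) = p $ 2"
      \<comment> \<open>The second coordinate determines \<open>z\<close>; then the sum and the
        difference of \<open>x\<close> and \<open>y\<close> are known.\<close>
      by (intro exI[of _ "(10 + p $ 2 - p $ 1) / 20"] exI[of _ "(10 + p $ 2 + p $ 1) / 20"] exI[of _ "- (p $ 2) / 10"])
        (auto simp: field_simps)
  qed auto
  finally show ?thesis .
qed

lemma obstacle_triangle:
  fixes a b c :: point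
  assumes "\<not> collinear {a, b, c}"
  shows "obstacle (interior (convex hull {a, b, c}))"
proof -
  let ?T = "convex hull {a, b, c}"
  have DIM2: "DIM(point) = 2" by simp
  have ne: "interior ?T \<noteq> {}"
  proof -
    have "(1/3) *\<^sub>R a + (1/3) *\<^sub>R b + (1/3) *\<^sub>R c \<in> interior ?T"
      unfolding interior_convex_hull_3_minimal[OF assms DIM2]
      by (intro CollectI exI[of _ "1/3"] conjI refl) auto
    then show ?thesis by blast
  qed
  have fr: "frontier (interior ?T) = closed_segment a b \<union> closed_segment b c \<union> closed_segment c a"
    using ne by (simp add: frontier_def convex_closure_interior flip: frontier_of_triangle)
  have "polygonal_set (frontier (interior ?T))"
    unfolding polygonal_set_def fr
    by (intro exI[of _ "{closed_segment a b, closed_segment b c, closed_segment c a}"]) auto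
  moreover have "frontier (interior ?T) homeomorphic sphere (0::point) 1"
  proof -
    \<comment> \<open>Bounded convex sets of equal dimension have homeomorphic relative frontiers;
      the triangle is compared with the open unit disc.\<close>
    have "rel_frontier (interior ?T) homeomorphic rel_frontier (ball (0::point) 1)"
      using ne by (intro homeomorphic_rel_frontiers_convex_bounded_sets)
        (auto simp: convex_interior aff_dim_open intro: bounded_subset[OF finite_imp_bounded_convex_hull interior_subset])
    moreover have "rel_frontier S = frontier S" if "open S" for S :: "point set"
      using that by (simp add: rel_frontier_def rel_interior_open frontier_def interior_open)
    ultimately show ?thesis by simp
  qed
  ultimately show ?thesis
    using ne by (simp add: obstacle_def convex_interior convex_connected)
qed

lemma B11_pos_edge_avoids_obst:
  assumes "u \<in> B11_V" "w \<in> B11_V" "B11_adj u w"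
  shows "closed_segment (B11_pos u) (B11_pos w) \<inter> obst = {}"
proof -
  consider "0 \<le> B11_y u" "0 \<le> B11_y w" | d :: real where "0 < d * orient (B11_pos u) (B11_pos w) obst_a"
    "0 < d * orient (B11_pos u) (B11_pos w) obst_b" "0 < d * orient (B11_pos u) (B11_pos w) obst_c"
    using B11_adj_pos[OF assms] that(1) that(2)[of 1] that(2)[of "- 1"]
      orient_B11_pos[of obst_a "- 10" 0] orient_B11_pos[of obst_b 10 0] orient_B11_pos[of obst_c 0 "- 10"]
    by fastforce
  then show ?thesis
  proof cases
    case 1
    have "p \<notin> obst" if p: "p \<in> closed_segment (B11_pos u) (B11_pos w)" for p
    proof -
      obtain t where "0 \<le> t" "t \<le> 1" "p = (1 - t) *\<^sub>R B11_pos u + t *\<^sub>R B11_pos w"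
        using p by (auto simp: in_segment)
      then have "0 \<le> p $ 2" using 1 by simp
      then show ?thesis by (simp add: mem_obst_iff)
    qed
    then show ?thesis by blast
  next
    case 2
    have "obst \<subseteq> {x. 0 < d * orient (B11_pos u) (B11_pos w) x}"
      unfolding obst_def using 2
      by (intro order_trans[OF interior_subset] hull_minimal convex_orient_pos) auto
    moreover have "closed_segment (B11_pos u) (B11_pos w) \<subseteq> {x. orient (B11_pos u) (B11_pos w) x = 0}"
      by (intro closed_segment_subset convex_orient_zero) auto
    ultimately show ?thesis by force
  qed
qed

lemma B11_pos_nonedge_meets_obst:
  assumes "u \<in> B11_V" "w \<in> B11_V" "u < w" "\<not> B11_adj u w"
  shows "closed_segment (B11_pos u) (B11_pos w) \<inter> obst \<noteq> {}"
proof -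
  note h = not_B11_adj_pos[OF assms]
  define d :: real where "d = of_int (B11_y u - B11_y w)"
  \<comment> \<open>Parameter at which the segment reaches height -1.\<close>
  define t where "t = of_int (B11_y u + 1) / d"
  let ?p = "(1 - t) *\<^sub>R B11_pos u + t *\<^sub>R B11_pos w"
  have d: "0 < d" using h unfolding d_def of_int_0_less_iff by linarith
  have td: "t * d = of_int (B11_y u + 1)" using d by (simp add: t_def)
  have t: "0 \<le> t" "t \<le> 1" unfolding t_def using d h
    by (auto simp: d_def divide_simps of_int_add[symmetric] of_int_diff[symmetric] simp del: of_int_add of_int_diff)
  have "?p $ 2 = of_int (B11_y u) - t * d" by (simp add: d_def algebra_simps)
  then have y: "?p $ 2 = - 1" by (simp add: td)
  have "?p $ 1 * d = of_int (B11_x u) * d + (t * d) * of_int (B11_x w - B11_x u)" by (simp add: algebra_simps)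
  also have "\<dots> = of_int (B11_x u * (B11_y u - B11_y w) + (B11_y u + 1) * (B11_x w - B11_x u))"
    unfolding td by (simp add: d_def)
  finally have "\<bar>?p $ 1\<bar> * d = of_int \<bar>B11_x u * (B11_y u - B11_y w) + (B11_y u + 1) * (B11_x w - B11_x u)\<bar>"
    using d by (metis abs_mult abs_of_pos of_int_abs)
  also have "\<dots> < of_int (9 * (B11_y u - B11_y w))" using h(3) unfolding of_int_less_iff .
  also have "\<dots> = 9 * d" by (simp add: d_def)
  finally have "\<bar>?p $ 1\<bar> < 9" using d by simp
  then have "?p \<in> obst" unfolding mem_obst_iff y by simp
  moreover have "?p \<in> closed_segment (B11_pos u) (B11_pos w)" using t by (auto simp: in_segment)
  ultimately show ?thesis by blast
qed

lemma B11_pos_orient_nonzero: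
  assumes "i \<in> B11_V" "j \<in> B11_V" "k \<in> B11_V" "i \<noteq> j" "i \<noteq> k" "j \<noteq> k"
  shows "orient (B11_pos i) (B11_pos j) (B11_pos k) \<noteq> 0"
proof -
  have sorted: "orient (B11_pos i) (B11_pos j) (B11_pos k) \<noteq> 0"
    if "i \<in> B11_V" "j \<in> B11_V" "k \<in> B11_V" "i < j" "j < k" for i j k
    using int_orient_B11_nonzero that by (simp add: orient_B11_pos[of _ "B11_x k" "B11_y k"])
  have "orient (B11_pos i) (B11_pos j) (B11_pos k) = - orient (B11_pos i) (B11_pos k) (B11_pos j)"
    "orient (B11_pos i) (B11_pos j) (B11_pos k) = orient (B11_pos j) (B11_pos k) (B11_pos i)"
    "orient (B11_pos i) (B11_pos j) (B11_pos k) = orient (B11_pos k) (B11_pos i) (B11_pos j)"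
    "orient (B11_pos i) (B11_pos k) (B11_pos j) = orient (B11_pos k) (B11_pos j) (B11_pos i)"
    "orient (B11_pos i) (B11_pos k) (B11_pos j) = orient (B11_pos j) (B11_pos i) (B11_pos k)"
    by (simp_all add: orient_def algebra_simps)
  then show ?thesis
    using assms sorted[of i j k] sorted[of i k j] sorted[of j i k] sorted[of j k i] sorted[of k i j] sorted[of k j i]
    by (metis linorder_neqE_nat neg_equal_0_iff_equal)
qed

lemma B11_pos_general_position: "general_position (B11_pos ` B11_V)"
  unfolding general_position_def
proof (intro allI impI)
  fix S assume S: "S \<subseteq> B11_pos ` B11_V" "card S = 3"
  then obtain x y z where xyz: "S = {x, y, z}" "x \<noteq> y" "x \<noteq> z" "y \<noteq> z" by (auto simp: card_3_iff)
  then obtain i j k where "i \<in> B11_V" "j \<in> B11_V" "k \<in> B11_V" "x = B11_pos i" "y = B11_pos j" "z = B11_pos k"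
    using S(1) by auto
  then show "\<not> collinear S"
    using xyz B11_pos_orient_nonzero[of i j k] by (auto simp: collinear_3_iff_orient)
qed

text \<open>Two coinciding points would be collinear with any third vertex, and one of 0, 1, 2 is
  always available as the third.\<close>

lemma B11_pos_inj: "inj_on B11_pos B11_V"
proof
  fix i j assume ij: "i \<in> B11_V" "j \<in> B11_V" "B11_pos i = B11_pos j"
  show "i = j"
  proof (rule ccontr)
    assume "i \<noteq> j"
    moreover have "\<not> {0, 1, 2 :: nat} \<subseteq> {i, j}" by auto
    then obtain k where "k \<in> {0, 1, 2}" "k \<notin> {i, j}" by blast
    then have "k \<in> B11_V" "k \<noteq> i" "k \<noteq> j" by (auto simp: B11_V_def)
    ultimately show False using B11_pos_orient_nonzero[of i j k] ij by auto
  qed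
qed

lemma B11_adj_sym: "B11_adj u w \<longleftrightarrow> B11_adj w u"
  by (auto simp: B11_adj_def)

lemma B11_inside_rep: "inside_obstacle_rep B11_V B11_adj B11_pos obst"
proof -
  have "B11_adj u w \<longleftrightarrow> u \<noteq> w \<and> closed_segment (B11_pos u) (B11_pos w) \<inter> obst = {}"
    if uw: "u \<in> B11_V" "w \<in> B11_V" for u w
  proof (cases u w rule: linorder_cases)
    case less
    then show ?thesis using B11_pos_nonedge_meets_obst[of u w] B11_pos_edge_avoids_obst[of u w] uw by blast
  next
    case greater
    then show ?thesis
      using B11_pos_nonedge_meets_obst[of w u] B11_pos_edge_avoids_obst[of w u] uw B11_adj_sym[of u w]
      by (auto simp: closed_segment_commute)
  qed (auto simp: B11_adj_def)
  moreover have "B11_pos ` B11_V \<inter> obst = {}"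
  proof -
    have "\<forall>n\<in>B11_V. 0 \<le> B11_y n \<or> B11_y n \<le> - 10 " by (simp add: B11_V_eq)
    then have "\<forall>n\<in>B11_V. 0 \<le> real_of_int (B11_y n) \<or> real_of_int (B11_y n) \<le> - 10" by fastforce
    then show ?thesis by (auto simp: mem_obst_iff)
  qed
  ultimately have "single_obstacle_rep B11_V B11_adj B11_pos obst"
    using obstacle_triangle[OF obst_not_collinear] B11_pos_general_position B11_pos_inj
    by (simp add: single_obstacle_rep_def flip: obst_def) (simp add: B11_V_def)
  moreover have "obst \<inter> K = {}" if K: "K \<in> components (- drawing B11_V B11_adj B11_pos)" "\<not> bounded K" for K
  proof -
    \<comment> \<open>Three pairwise adjacent vertices, \<open>z\<^sub>1\<close>,
      \<open>z\<^sub>4\<close> and \<open>z\<^sub>2'\<close>, whose triangle contains the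
      obstacle.\<close>
    let ?T = "convex hull {B11_pos 1, B11_pos 4, B11_pos 7}"
    have "obst_a \<in> ?T" "obst_b \<in> ?T" "obst_c \<in> ?T"
      by (rule mem_triangle_orient; simp add: orient_def)+
    then have "convex hull {obst_a, obst_b, obst_c} \<subseteq> ?T" by (intro hull_minimal) auto
    then have obst: "obst \<subseteq> ?T" unfolding obst_def using interior_subset by blast
    have "closed_segment (B11_pos u) (B11_pos w) \<subseteq> drawing B11_V B11_adj B11_pos"
      if "B11_adj u w" for u w
      using that by (intro drawing_edge) (auto simp: B11_adj_def)
    then have "frontier ?T \<subseteq> drawing B11_V B11_adj B11_pos"
      by (simp add: frontier_of_triangle B11_adj_def B11_V_def)
    then have "K \<inter> frontier ?T = {}" using in_components_subset[OF K(1)] by blast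
    moreover have "bounded ?T" by (simp add: finite_imp_bounded_convex_hull)
    ultimately have "K \<inter> ?T = {}"
      using bounded_component_enclosed[OF in_components_connected[OF K(1)]] K(2) by blast
    then show ?thesis using obst by blast
  qed
  ultimately show ?thesis by (auto simp: inside_obstacle_rep_def)
qed

theorem theorem3:
  shows "(\<exists>f C a b c. inside_obstacle_rep B11_V B11_adj f C \<and>
            \<not> collinear {a, b, c} \<and> C = interior (convex hull {a, b, c})) \<and>
         \<not> (\<exists>f C. outside_obstacle_rep B11_V B11_adj f C)"
  using B11_inside_rep obst_not_collinear obst_def B11_no_outside_rep by blast

end
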